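(* Let $n\in\mathbb{N}$. Then $$\sum_{\sigma\in D_n}x^{\mathrm{dstc}(\sigma)}q^{\ell(\sigma)}=\sum_{\sigma\in D_n}x^{\mathrm{ddes}(\sigma)}q^{\mathrm{dmaj}(\sigma)}.$$
   Context: $[n]=\{1,\ldots,n\}$. The hyperoctahedral group $B_n$ is the group of signed permutations: bijections $\sigma$ of $\{\pm1,\ldots,\pm n\}$ with $\sigma(-i)=-\sigma(i)$, written $\sigma=\sigma_1\cdots\sigma_n$ with $\sigma_i=\sigma(i)$. For $\sigma\in B_n$: $\mathrm{Neg}(\sigma)=\{i\in[n] : \sigma(i)<0\}$, $\mathrm{neg}(\sigma)=|\mathrm{Neg}(\sigma)|$. The even hyperoctahedral group is $D_n=\{\sigma\in B_n : \mathrm{neg}(\sigma)\equiv0\pmod 2\}$. $\mathrm{Des}(\sigma)=\{i\in[n-1] : \sigma(i)>\sigma(i+1)\}$, $\mathrm{des}(\sigma)=|\mathrm{Des}(\sigma)|$, $\mathrm{maj}(\sigma)=\sum_{i\in\mathrm{Des}(\sigma)}i$; $\mathrm{inv}(\sigma)=|\{(i,j)\in[n]\times[n] : i<j,\ \sigma(i)>\sigma(j)\}|$; $\mathrm{nsp}(\sigma)=|\{(i,j)\in[n]\times[n] : i<j,\ \sigma(i)+\sigma(j)<0\}|$. The Coxeter length on $D_n$ is $\ell(\sigma)=\mathrm{inv}(\sigma)+\mathrm{nsp}(\sigma)$. Type $D$ descent number and major index: with $\mathrm{DNeg}(\sigma):=\{i\in[n] : \sigma(i)<-1\}$, $$\mathrm{ddes}(\sigma)=\mathrm{des}(\sigma)+|\mathrm{DNeg}(\sigma)|,\qquad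 \mathrm{dmaj}(\sigma)=\mathrm{maj}(\sigma)+\sum_{i\in\mathrm{DNeg}(\sigma)}(|\sigma(i)|-1).$$ The statistic stc: for $\sigma\in B_n$ (using the usual order on integers), $\mathrm{code}(\sigma)=c_1\cdots c_n$ with $c_i=|\{j : i<j\le n,\ \sigma(i)>\sigma(j)\}|$. For a word $w=w_1\cdots w_n$ of nonnegative integers with $w_i\le n-i$, $\mathrm{st}(w)$ is the largest $r\in[n]$ for which there exist indices $i_1<\cdots<i_r$ such that $w_{i_j}>r-j$ for all $j=1,\ldots,r$; $\mathrm{st}(w)=0$ if no such $r$ exists. Then $\mathrm{stc}(\sigma):=\mathrm{st}(\mathrm{code}(\sigma))$. Finally, $\mathrm{dstc}(\sigma):=\mathrm{stc}(\sigma)+|\mathrm{DNeg}(\sigma)|=\mathrm{stc}(\sigma)+\mathrm{neg}(\sigma)+\varepsilon(\sigma)$, where $\varepsilon(\sigma)=-1$ if $\sigma^{-1}(1)<0$ and $\varepsilon(\sigma)=0$ otherwise. *)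

theory Defs
  imports Main "HOL-Combinatorics.Permutations"
begin

text \<open>
  Signed permutations of \<open>{\<plusminus>1, \<dots>, \<plusminus>n}\<close> are represented by functions on all
  integers that fix every integer outside this set; so each bijection of the set corresponds to
  exactly one such function. Positions \<open>i \<in> [n]\<close> are natural numbers, and the one-line
  entry at position \<open>i\<close> is \<open>\<sigma> (int i)\<close>. None of the statistics can recover \<open>n\<close>
  from the function, so \<open>n\<close> is an explicit argument.
\<close>

definition hyperoctahedral :: "nat \<Rightarrow> (int \<Rightarrow> int) set" where
  "hyperoctahedral n =
     {\<sigma>. \<sigma> permutes ({- int n..int n} - {0}) \<and> (\<forall>i. \<sigma> (- i) = - \<sigma> i)}"

definition Neg :: "nat \<Rightarrow> (int \<Rightarrow> int) \<Rightarrow> nat set" where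
  "Neg n \<sigma> = {i \<in> {1..n}. \<sigma> (int i) < 0}"

definition neg :: "nat \<Rightarrow> (int \<Rightarrow> int) \<Rightarrow> nat" where
  "neg n \<sigma> = card (Neg n \<sigma>)"

definition even_hyperoctahedral :: "nat \<Rightarrow> (int \<Rightarrow> int) set" where
  "even_hyperoctahedral n = {\<sigma> \<in> hyperoctahedral n. even (neg n \<sigma>)}"

definition Des :: "nat \<Rightarrow> (int \<Rightarrow> int) \<Rightarrow> nat set" where
  "Des n \<sigma> = {i \<in> {1..n - 1}. \<sigma> (int i) > \<sigma> (int (i + 1))}"

definition des :: "nat \<Rightarrow> (int \<Rightarrow> int) \<Rightarrow> nat" where
  "des n \<sigma> = card (Des n \<sigma>)"

definition maj :: "nat \<Rightarrow> (int \<Rightarrow> int) \<Rightarrow> nat" where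
  "maj n \<sigma> = (\<Sum>i\<in>Des n \<sigma>. i)"

definition inversions :: "nat \<Rightarrow> (int \<Rightarrow> int) \<Rightarrow> nat" where
  "inversions n \<sigma> =
     card {(i, j). i \<in> {1..n} \<and> j \<in> {1..n} \<and> i < j \<and> \<sigma> (int i) > \<sigma> (int j)}"

definition nsp :: "nat \<Rightarrow> (int \<Rightarrow> int) \<Rightarrow> nat" where
  "nsp n \<sigma> =
     card {(i, j). i \<in> {1..n} \<and> j \<in> {1..n} \<and> i < j \<and> \<sigma> (int i) + \<sigma> (int j) < 0}"

definition length_D :: "nat \<Rightarrow> (int \<Rightarrow> int) \<Rightarrow> nat" where
  "length_D n \<sigma> = inversions n \<sigma> + nsp n \<sigma>"

definition DNeg :: "nat \<Rightarrow> (int \<Rightarrow> int) \<Rightarrow> nat set" where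
  "DNeg n \<sigma> = {i \<in> {1..n}. \<sigma> (int i) < - 1}"

definition ddes :: "nat \<Rightarrow> (int \<Rightarrow> int) \<Rightarrow> nat" where
  "ddes n \<sigma> = des n \<sigma> + card (DNeg n \<sigma>)"

definition dmaj :: "nat \<Rightarrow> (int \<Rightarrow> int) \<Rightarrow> nat" where
  "dmaj n \<sigma> = maj n \<sigma> + (\<Sum>i\<in>DNeg n \<sigma>. nat (\<bar>\<sigma> (int i)\<bar> - 1))"

definition code :: "nat \<Rightarrow> (int \<Rightarrow> int) \<Rightarrow> nat \<Rightarrow> nat" where
  "code n \<sigma> i = card {j. i < j \<and> j \<le> n \<and> \<sigma> (int i) > \<sigma> (int j)}"

text \<open>
  A word \<open>w\<^sub>1 \<cdots> w\<^sub>n\<close> is a function of which only the values on \<open>{1..n}\<close> matter, and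
  \<open>\<iota> j\<close> is the index \<open>i\<^sub>j\<close>.
\<close>

definition st_witness :: "nat \<Rightarrow> (nat \<Rightarrow> nat) \<Rightarrow> nat \<Rightarrow> bool" where
  "st_witness n w r \<longleftrightarrow>
     (\<exists>\<iota>. strict_mono_on {1..r} \<iota> \<and> \<iota> ` {1..r} \<subseteq> {1..n} \<and>
          (\<forall>j\<in>{1..r}. w (\<iota> j) > r - j))"

definition st :: "nat \<Rightarrow> (nat \<Rightarrow> nat) \<Rightarrow> nat" where
  "st n w =
     (if \<exists>r\<in>{1..n}. st_witness n w r then Max {r \<in> {1..n}. st_witness n w r} else 0)"

definition stc :: "nat \<Rightarrow> (int \<Rightarrow> int) \<Rightarrow> nat" where
  "stc n \<sigma> = st n (code n \<sigma>)"

definition dstc :: "nat \<Rightarrow> (int \<Rightarrow> int) \<Rightarrow> nat" where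
  "dstc n \<sigma> = stc n \<sigma> + card (DNeg n \<sigma>)"

definition eps :: "(int \<Rightarrow> int) \<Rightarrow> int" where
  "eps \<sigma> = (if inv \<sigma> 1 < 0 then - 1 else 0)"

lemma finite_hyperoctahedral: "finite (hyperoctahedral n)"
proof -
  have "finite {\<sigma>. \<sigma> permutes ({- int n..int n} - {0})}"
    by (rule finite_permutations) simp
  then show ?thesis
    by (rule rev_finite_subset) (auto simp: hyperoctahedral_def)
qed

lemma finite_even_hyperoctahedral: "finite (even_hyperoctahedral n)"
  using finite_hyperoctahedral by (simp add: even_hyperoctahedral_def)

lemma dstc_eq_neg_eps:
  assumes "\<sigma> \<in> hyperoctahedral n"
  shows "int (dstc n \<sigma>) = int (stc n \<sigma>) + int (neg n \<sigma>) + eps \<sigma>"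
proof -
  have perm: "\<sigma> permutes ({- int n..int n} - {0})" and odd: "\<And>i. \<sigma> (- i) = - \<sigma> i"
    using assms by (auto simp: hyperoctahedral_def)
  have bij: "bij \<sigma>" using perm by (rule permutes_bij)
  define k where "k = inv \<sigma> 1"
  have k: "\<sigma> k = 1" unfolding k_def using bij by (simp add: bij_is_surj surj_f_inv_f)
  have uniq: "\<sigma> i = - 1 \<longleftrightarrow> i = - k" for i
    using odd[of k] k bij by (metis bij_is_inj injD)
  have split: "Neg n \<sigma> = DNeg n \<sigma> \<union> {i \<in> {1..n}. \<sigma> (int i) = - 1}"
    by (auto simp: Neg_def DNeg_def)
  have "card (Neg n \<sigma>) = card (DNeg n \<sigma>) + card {i \<in> {1..n}. \<sigma> (int i) = - 1}"
    unfolding split by (rule card_Un_disjoint) (auto simp: DNeg_def)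
  moreover have "int (card {i \<in> {1..n}. \<sigma> (int i) = - 1}) = - eps \<sigma>"
  proof (cases "k < 0")
    case True
    have "k \<in> {- int n..int n} - {0}"
    proof (rule ccontr)
      assume "k \<notin> {- int n..int n} - {0}"
      then have "\<sigma> k = k" using perm by (simp add: permutes_def)
      then show False using k True by simp
    qed
    then have "{i \<in> {1..n}. \<sigma> (int i) = - 1} = {nat (- k)}"
      using True unfolding uniq by auto
    then show ?thesis using True by (simp add: eps_def k_def)
  next
    case False
    then have "{i \<in> {1..n}. \<sigma> (int i) = - 1} = {}"
      unfolding uniq by auto
    then show ?thesis using False by (simp add: eps_def k_def)
  qed
  ultimately show ?thesis by (simp add: dstc_def neg_def)
qed

end

theory Submission
  imports Defs "HOL-Combinatorics.Multiset_Permutations"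
begin

text \<open>
  Write a signed permutation as its one-line word \<open>w\<close>, and let \<open>V\<close> be the set of its letters: a
  choice of one element from each pair \<open>\<plusminus>1, \<dots>, \<plusminus>n\<close>. The letters can be arranged in any
  order, so the signed permutations with letter set \<open>V\<close> are the arrangements of \<open>V\<close>. Whether the
  permutation lies in \<open>D\<^sub>n\<close> depends on \<open>V\<close> alone, and so do the number of letters below \<open>-1\<close> and
  the sum of \<open>\<bar>v\<bar> - 1\<close> over the negative letters \<open>v\<close>. The latter is the amount by which \<open>dmaj\<close>
  exceeds \<open>maj\<close>. It is also \<open>nsp\<close>: the sum of two letters is negative exactly if the one of larger
  absolute value is, and \<open>v\<close> has the larger absolute value in \<open>\<bar>v\<bar> - 1\<close> pairs
  (\<open>signed_statistics\<close>). On each fibre \<open>V\<close> both sides of the identity thus receive the same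
  monomial factor, and it remains to see that \<open>(stc, inv)\<close> and \<open>(des, maj)\<close> have the same joint
  distribution on the arrangements of any finite linearly ordered set \<open>V\<close>
  (\<open>stc_inv_equidistributed_des_maj\<close>, a theorem of Skandera).

  Both pairs \<open>(r, s)\<close> obey one recursion. Passing from \<open>n\<close> to \<open>n + 1\<close> letters can be done in \<open>n + 1\<close>
  ways, indexed by \<open>c \<in> {0..n}\<close> such that \<open>s\<close> grows by \<open>c\<close>, and \<open>r\<close> grows by \<open>1\<close> if \<open>c > r\<close> and
  not at all otherwise. For \<open>(stc, inv)\<close> a letter is put in front, and \<open>c\<close> is its code entry
  (\<open>sum_stc_inv\<close>). For \<open>(des, maj)\<close> a new maximum is inserted somewhere, and Carlitz's insertion
  lemma says that the increments of \<open>maj\<close> run through \<open>{0..n}\<close> with the required effect on \<open>des\<close>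
  (\<open>bij_betw_maj_increment\<close>, \<open>insert_at_des_maj\<close>, \<open>sum_des_maj\<close>).
\<close>

section \<open>One-line words\<close>

definition word :: "nat \<Rightarrow> (int \<Rightarrow> int) \<Rightarrow> int list" where
  "word n \<sigma> = map (\<lambda>i. \<sigma> (int i)) [1..<Suc n]"

lemma length_word [simp]: "length (word n \<sigma>) = n"
  by (simp add: word_def)

lemma nth_word: "i < n \<Longrightarrow> word n \<sigma> ! i = \<sigma> (int (Suc i))"
  by (simp add: word_def del: upt_Suc)

lemma word_0 [simp]: "word 0 \<sigma> = []"
  by (simp add: word_def)

lemma word_Suc: "word (Suc n) \<sigma> = \<sigma> 1 # word n (\<lambda>i. \<sigma> (i + 1))"
  by (rule nth_equalityI) (auto simp: nth_word nth_Cons add.commute split: nat.splits)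

lemma length_filter_word:
  "length (filter P (word n \<sigma>)) = card {j \<in> {1..n}. P (\<sigma> (int j))}"
proof -
  have "length (filter P (word n \<sigma>)) = length (filter (\<lambda>j. P (\<sigma> (int j))) [1..<Suc n])"
    by (simp add: word_def filter_map o_def del: upt_Suc)
  also have "\<dots> = card ({j. P (\<sigma> (int j))} \<inter> set [1..<Suc n])"
    by (rule distinct_length_filter) simp
  also have "{j. P (\<sigma> (int j))} \<inter> set [1..<Suc n] = {j \<in> {1..n}. P (\<sigma> (int j))}"
    by auto
  finally show ?thesis .
qed

section \<open>Statistics on words\<close>

definition raise :: "nat \<Rightarrow> nat \<Rightarrow> nat" where
  "raise c r = (if r < c then Suc r else r)"

text \<open>
  This is \<open>st\<close> of the code of the word: the filtered length is the first code entry, and \<open>st_Suc\<close> below shows that \<open>st\<close> can be computed from the right in this way.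
\<close>

fun stc_word :: "'a::linorder list \<Rightarrow> nat" where
  "stc_word [] = 0"
| "stc_word (x # w) = raise (length (filter (\<lambda>y. y < x) w)) (stc_word w)"

fun count_pairs :: "('a \<Rightarrow> 'a \<Rightarrow> bool) \<Rightarrow> 'a list \<Rightarrow> nat" where
  "count_pairs P [] = 0"
| "count_pairs P (x # w) = length (filter (P x) w) + count_pairs P w"

text \<open>
  Descents are positions counted from \<open>1\<close>, whereas list entries are indexed from \<open>0\<close>: the descent
  \<open>i\<close> compares the \<open>i\<close>th letter \<open>w ! (i - 1)\<close> with the next one.
\<close>

definition descents :: "'a::linorder list \<Rightarrow> nat set" where
  "descents w = {i \<in> {0<..<length w}. w ! i < w ! (i - 1)}"

lemma finite_descents [simp]: "finite (descents w)"
  by (simp add: descents_def)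

lemma Des_eq_descents: "Des n \<sigma> = descents (word n \<sigma>)"
  by (auto simp: Des_def descents_def nth_word)

text \<open>
  Stated for an arbitrary relation, so that it yields both \<open>inversions\<close> and \<open>nsp\<close>. The pairs with
  first position \<open>1\<close> are split off; the others are the pairs of the shifted permutation.
\<close>

lemma card_pairs_eq_count_pairs:
  "card {(i, j). i \<in> {1..n} \<and> j \<in> {1..n} \<and> i < j \<and> P (\<sigma> (int i)) (\<sigma> (int j))} =
   count_pairs P (word n \<sigma>)"
proof (induction n arbitrary: \<sigma>)
  case (Suc n)
  define \<tau> where "\<tau> = (\<lambda>i. \<sigma> (i + 1))"
  define A where "A = {j \<in> {1..n}. P (\<sigma> 1) (\<tau> (int j))}"
  define B where "B = {(i, j). i \<in> {1..n} \<and> j \<in> {1..n} \<and> i < j \<and> P (\<tau> (int i)) (\<tau> (int j))}"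
  have "finite A" by (simp add: A_def)
  moreover have "finite B"
    by (rule finite_subset[of _ "{1..n} \<times> {1..n}"]) (auto simp: B_def)
  moreover have "{(i, j). i \<in> {1..Suc n} \<and> j \<in> {1..Suc n} \<and> i < j \<and> P (\<sigma> (int i)) (\<sigma> (int j))} =
      (\<lambda>j. (1, Suc j)) ` A \<union> map_prod Suc Suc ` B" (is "?L = ?R")
  proof (intro equalityI subsetI)
    fix p assume "p \<in> ?L"
    then obtain i j where p: "p = (i, j)" "1 \<le> i" "i < j" "j \<le> Suc n" "P (\<sigma> (int i)) (\<sigma> (int j))"
      by auto
    then obtain i' j' where s: "i = Suc i'" "j = Suc j'"
      by (metis Suc_le_D less_imp_le less_le_trans One_nat_def gr0_implies_Suc)
    show "p \<in> ?R"
    proof (cases "i' = 0")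
      case True
      then have "j' \<in> A" using p s by (auto simp: A_def \<tau>_def add.commute)
      then show ?thesis using p s True by auto
    next
      case False
      then have "(i', j') \<in> B" using p s by (auto simp: B_def \<tau>_def add.commute)
      then show ?thesis using p s by force
    qed
  qed (auto simp: A_def B_def \<tau>_def add.commute)
  moreover have "(\<lambda>j. (1, Suc j)) ` A \<inter> map_prod Suc Suc ` B = {}"
    by (auto simp: B_def)
  moreover have "card ((\<lambda>j. (1::nat, Suc j)) ` A) = card A"
    by (rule card_image) (auto simp: inj_on_def)
  moreover have "card (map_prod Suc Suc ` B) = card B"
    by (rule card_image) (auto simp: inj_on_def)
  ultimately have "card {(i, j). i \<in> {1..Suc n} \<and> j \<in> {1..Suc n} \<and> i < j \<and>
      P (\<sigma> (int i)) (\<sigma> (int j))} = card A + card B"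
    by (simp only: card_Un_disjoint finite_imageI)
  also have "card A = length (filter (P (\<sigma> 1)) (word n \<tau>))"
    by (simp add: A_def length_filter_word)
  also have "card B = count_pairs P (word n \<tau>)"
    unfolding B_def by (rule Suc.IH)
  finally show ?case by (simp add: word_Suc \<tau>_def)
qed simp

lemma st_witness_0: "st_witness n w 0"
  by (auto simp: st_witness_def)

text \<open>
  The two cases on the right are whether or not the chosen subword starts at position \<open>1\<close>. If it
  does, its first letter must exceed \<open>(r + 1) - 1\<close>, and the bounds \<open>(r + 1) - (j + 1) = r - j\<close> for the
  other letters are those of a witness of length \<open>r\<close>.
\<close>

lemma st_witness_Suc:
  "st_witness (Suc n) w (Suc r) \<longleftrightarrow>
   st_witness n (\<lambda>i. w (Suc i)) (Suc r) \<or> r < w 1 \<and> st_witness n (\<lambda>i. w (Suc i)) r"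
proof
  assume "st_witness (Suc n) w (Suc r)"
  then obtain \<iota> where \<iota>: "strict_mono_on {1..Suc r} \<iota>" "\<iota> ` {1..Suc r} \<subseteq> {1..Suc n}"
    and big: "\<And>j. j \<in> {1..Suc r} \<Longrightarrow> w (\<iota> j) > Suc r - j"
    unfolding st_witness_def by blast
  have mono: "\<iota> i < \<iota> j" if "i \<in> {1..Suc r}" "j \<in> {1..Suc r}" "i < j" for i j
    using \<iota>(1) that by (rule strict_mono_onD)
  have range: "\<iota> j \<in> {1..Suc n}" if "j \<in> {1..Suc r}" for j
    using \<iota>(2) that by blast
  show "st_witness n (\<lambda>i. w (Suc i)) (Suc r) \<or> r < w 1 \<and> st_witness n (\<lambda>i. w (Suc i)) r"
  proof (cases "\<iota> 1 = 1")
    case True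
    have gt: "\<iota> (Suc j) > 1" if "j \<in> {1..r}" for j
      using mono[of 1 "Suc j"] that True by auto
    have "st_witness n (\<lambda>i. w (Suc i)) r"
      unfolding st_witness_def
    proof (intro exI[of _ "\<lambda>j. \<iota> (Suc j) - 1"] conjI ballI)
      show "strict_mono_on {1..r} (\<lambda>j. \<iota> (Suc j) - 1)"
      proof (rule strict_mono_onI)
        fix i j assume "i \<in> {1..r}" "j \<in> {1..r}" "i < j"
        then show "\<iota> (Suc i) - 1 < \<iota> (Suc j) - 1"
          using mono[of "Suc i" "Suc j"] gt[of i] by auto
      qed
      show "(\<lambda>j. \<iota> (Suc j) - 1) ` {1..r} \<subseteq> {1..n}"
        using gt range by fastforce
      show "r - j < w (Suc (\<iota> (Suc j) - 1))" if "j \<in> {1..r}" for j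
        using gt[OF that] big[of "Suc j"] that by auto
    qed
    moreover have "r < w 1" using big[of 1] True by simp
    ultimately show ?thesis by blast
  next
    case False
    have gt: "\<iota> j > 1" if "j \<in> {1..Suc r}" for j
    proof (cases "j = 1")
      case True
      then show ?thesis using False range[of 1] by auto
    next
      case False
      then show ?thesis using mono[of 1 j] range[of 1] that by auto
    qed
    have "st_witness n (\<lambda>i. w (Suc i)) (Suc r)"
      unfolding st_witness_def
    proof (intro exI[of _ "\<lambda>j. \<iota> j - 1"] conjI ballI)
      show "strict_mono_on {1..Suc r} (\<lambda>j. \<iota> j - 1)"
      proof (rule strict_mono_onI)
        fix i j assume "i \<in> {1..Suc r}" "j \<in> {1..Suc r}" "i < j"
        then show "\<iota> i - 1 < \<iota> j - 1"
          using mono[of i j] gt[of i] by auto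
      qed
      show "(\<lambda>j. \<iota> j - 1) ` {1..Suc r} \<subseteq> {1..n}"
        using gt range by fastforce
      show "Suc r - j < w (Suc (\<iota> j - 1))" if "j \<in> {1..Suc r}" for j
        using gt[OF that] big[OF that] by auto
    qed
    then show ?thesis ..
  qed
next
  assume "st_witness n (\<lambda>i. w (Suc i)) (Suc r) \<or> r < w 1 \<and> st_witness n (\<lambda>i. w (Suc i)) r"
  then show "st_witness (Suc n) w (Suc r)"
  proof
    assume "st_witness n (\<lambda>i. w (Suc i)) (Suc r)"
    then obtain \<iota> where "strict_mono_on {1..Suc r} \<iota>" "\<iota> ` {1..Suc r} \<subseteq> {1..n}"
      "\<forall>j\<in>{1..Suc r}. w (Suc (\<iota> j)) > Suc r - j"
      by (auto simp: st_witness_def)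
    then show ?thesis
      unfolding st_witness_def
      by (intro exI[of _ "\<lambda>j. Suc (\<iota> j)"]) (auto simp: strict_mono_on_def)
  next
    assume "r < w 1 \<and> st_witness n (\<lambda>i. w (Suc i)) r"
    then obtain \<iota> where w1: "r < w 1"
      and \<iota>: "strict_mono_on {1..r} \<iota>" "\<iota> ` {1..r} \<subseteq> {1..n}"
      and big: "\<And>j. j \<in> {1..r} \<Longrightarrow> w (Suc (\<iota> j)) > r - j"
      unfolding st_witness_def by blast
    have mono: "\<iota> i < \<iota> j" if "i \<in> {1..r}" "j \<in> {1..r}" "i < j" for i j
      using \<iota>(1) that by (rule strict_mono_onD)
    have range: "\<iota> j \<in> {1..n}" if "j \<in> {1..r}" for j
      using \<iota>(2) that by blast
    show ?thesis
      unfolding st_witness_def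
    proof (intro exI[of _ "\<lambda>j. if j \<le> 1 then 1 else Suc (\<iota> (j - 1))"] conjI ballI)
      show "strict_mono_on {1..Suc r} (\<lambda>j. if j \<le> 1 then 1 else Suc (\<iota> (j - 1)))"
      proof (rule strict_mono_onI)
        fix i j assume ij: "i \<in> {1..Suc r}" "j \<in> {1..Suc r}" "i < j"
        then have "j - 1 \<in> {1..r}" by auto
        then have "\<iota> (j - 1) \<ge> 1" using range by fastforce
        then show "(if i \<le> 1 then 1 else Suc (\<iota> (i - 1))) < (if j \<le> 1 then 1 else Suc (\<iota> (j - 1)))"
          using mono[of "i - 1" "j - 1"] ij by auto
      qed
      show "(\<lambda>j. if j \<le> 1 then 1 else Suc (\<iota> (j - 1))) ` {1..Suc r} \<subseteq> {1..Suc n}"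
      proof (intro image_subsetI)
        fix j assume "j \<in> {1..Suc r}"
        then have "j - 1 \<in> {1..r}" if "\<not> j \<le> 1" using that by auto
        then show "(if j \<le> 1 then 1 else Suc (\<iota> (j - 1))) \<in> {1..Suc n}"
          using range[of "j - 1"] by auto
      qed
      show "Suc r - j < w (if j \<le> 1 then 1 else Suc (\<iota> (j - 1)))" if "j \<in> {1..Suc r}" for j
      proof (cases "j = 1")
        case False
        then have "j - 1 \<in> {1..r}" "r - (j - 1) = Suc r - j" "\<not> j \<le> 1" using that by auto
        then show ?thesis using big[of "j - 1"] by simp
      qed (simp add: w1[simplified])
    qed
  qed
qed

lemma st_eqI:
  assumes "s \<le> n" and "\<And>r. st_witness n w r \<longleftrightarrow> r \<le> s"
  shows "st n w = s"
proof -
  have set: "{r \<in> {1..n}. st_witness n w r} = {1..s}"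
    unfolding assms(2) using assms(1) by auto
  show ?thesis
  proof (cases "s = 0")
    case True
    then show ?thesis by (auto simp: st_def assms(2))
  next
    case False
    then have "\<exists>r\<in>{1..n}. st_witness n w r"
      using assms(1) unfolding assms(2) by (intro bexI[of _ s]) auto
    moreover have "Max {1..s} = s" using False by (intro Max_eqI) auto
    ultimately show ?thesis by (simp only: st_def set if_True)
  qed
qed

text \<open>
  The lengths \<open>r\<close> that admit a witness form an initial segment of the naturals: this is carried
  through the induction, since the step compares a maximum with each \<open>r\<close>. A new first letter
  \<open>c\<close> lengthens a longest witness, of length \<open>r\<close>, exactly if it can be put in front of it,
  which requires \<open>c > r\<close>.
\<close>

lemma st_Suc: "st (Suc n) w = raise (w 1) (st n (\<lambda>i. w (Suc i)))"
proof -
  have step: "st (Suc n) w = raise (w 1) (st n (\<lambda>i. w (Suc i))) \<and>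
      st (Suc n) w \<le> Suc n \<and> (\<forall>r. st_witness (Suc n) w r \<longleftrightarrow> r \<le> st (Suc n) w)"
    if IH: "st n (\<lambda>i. w (Suc i)) \<le> n"
      "\<And>r. st_witness n (\<lambda>i. w (Suc i)) r \<longleftrightarrow> r \<le> st n (\<lambda>i. w (Suc i))" for n w
  proof -
    define s where "s = raise (w 1) (st n (\<lambda>i. w (Suc i)))"
    have le: "s \<le> Suc n" using IH(1) by (simp add: s_def raise_def)
    have iff: "st_witness (Suc n) w r \<longleftrightarrow> r \<le> s" for r
    proof (cases r)
      case 0
      then show ?thesis by (simp add: st_witness_0)
    next
      case (Suc r')
      then show ?thesis by (auto simp: st_witness_Suc IH(2) s_def raise_def)
    qed
    have "st (Suc n) w = s" by (rule st_eqI[OF le iff])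
    then show ?thesis using le iff by (simp add: s_def)
  qed
  have main: "st n w \<le> n \<and> (\<forall>r. st_witness n w r \<longleftrightarrow> r \<le> st n w)" for n w
  proof (induction n arbitrary: w)
    case 0
    have "st_witness 0 w r \<longleftrightarrow> r \<le> 0" for r
      by (auto simp: st_witness_0) (auto simp: st_witness_def)
    moreover from this have "st 0 w = 0" by (intro st_eqI) auto
    ultimately show ?case by simp
  next
    case (Suc n)
    then show ?case using step by blast
  qed
  show "st (Suc n) w = raise (w 1) (st n (\<lambda>i. w (Suc i)))"
    using step main by blast
qed

lemma code_Suc: "code (Suc n) \<sigma> (Suc i) = code n (\<lambda>i. \<sigma> (i + 1)) i"
proof -
  have "{j. Suc i < j \<and> j \<le> Suc n \<and> \<sigma> (int (Suc i)) > \<sigma> (int j)} =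
      Suc ` {j. i < j \<and> j \<le> n \<and> \<sigma> (int i + 1) > \<sigma> (int j + 1)}" (is "?L = Suc ` ?R")
  proof (intro equalityI subsetI)
    fix j assume "j \<in> ?L"
    then have "j = Suc (j - 1)" "j - 1 \<in> ?R"
      by (auto simp: add.commute of_nat_diff)
    then show "j \<in> Suc ` ?R" by blast
  qed (auto simp: add.commute)
  then show ?thesis by (simp add: code_def card_image)
qed

lemma code_1: "code (Suc n) \<sigma> 1 = length (filter (\<lambda>y. y < \<sigma> 1) (word n (\<lambda>i. \<sigma> (i + 1))))"
proof -
  have "{j. 1 < j \<and> j \<le> Suc n \<and> \<sigma> (int 1) > \<sigma> (int j)} =
      Suc ` {j \<in> {1..n}. \<sigma> (int j + 1) < \<sigma> 1}" (is "?L = Suc ` ?R")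
  proof (intro equalityI subsetI)
    fix j assume "j \<in> ?L"
    then have "j = Suc (j - 1)" "j - 1 \<in> ?R"
      by (auto simp: add.commute of_nat_diff)
    then show "j \<in> Suc ` ?R" by blast
  qed (auto simp: add.commute)
  then show ?thesis by (simp add: code_def card_image length_filter_word)
qed

lemma stc_eq_stc_word: "stc n \<sigma> = stc_word (word n \<sigma>)"
proof (induction n arbitrary: \<sigma>)
  case 0
  then show ?case by (simp add: stc_def st_def)
next
  case (Suc n)
  have "stc (Suc n) \<sigma> = raise (code (Suc n) \<sigma> 1) (stc n (\<lambda>i. \<sigma> (i + 1)))"
    by (simp add: stc_def st_Suc code_Suc)
  then show ?case by (simp add: Suc.IH word_Suc code_1[simplified])
qed

section \<open>The Euler--Mahonian recursion\<close>

text \<open>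
  The common value of the sums of \<open>f r s\<close> over the arrangements of \<open>n\<close> letters, for an
  Euler--Mahonian pair \<open>(r, s)\<close>. The weight \<open>f\<close> is arbitrary so that the recursion can be expressed
  by changing the weight, without polynomials.
\<close>

fun em_sum :: "nat \<Rightarrow> (nat \<Rightarrow> nat \<Rightarrow> 'b::comm_monoid_add) \<Rightarrow> 'b" where
  "em_sum 0 f = f 0 0"
| "em_sum (Suc n) f = em_sum n (\<lambda>r s. \<Sum>c\<le>n. f (raise c r) (s + c))"

lemma em_sum_sum: "em_sum n (\<lambda>r s. \<Sum>i\<in>I. f i r s) = (\<Sum>i\<in>I. em_sum n (f i))"
proof (induction n arbitrary: f)
  case (Suc n)
  have "(\<lambda>r s. \<Sum>c\<le>n. \<Sum>i\<in>I. f i (raise c r) (s + c)) =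
      (\<lambda>r s. \<Sum>i\<in>I. \<Sum>c\<le>n. f i (raise c r) (s + c))"
    by (intro ext sum.swap)
  then show ?case by (simp add: Suc.IH)
qed simp

lemma bij_betw_rank:
  fixes V :: "'a::linorder set"
  assumes "finite V" and "card V = Suc n"
  shows "bij_betw (\<lambda>x. card {y \<in> V. y < x}) V {..n}"
proof -
  have mono: "card {y \<in> V. y < x} < card {y \<in> V. y < z}" if "x \<in> V" "x < z" for x z
    by (rule psubset_card_mono) (use assms that in auto)
  have inj: "inj_on (\<lambda>x. card {y \<in> V. y < x}) V"
  proof (rule inj_onI)
    fix x z assume "x \<in> V" "z \<in> V" "card {y \<in> V. y < x} = card {y \<in> V. y < z}"
    then show "x = z" using mono[of x z] mono[of z x] by (cases x z rule: linorder_cases) auto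
  qed
  have "card {y \<in> V. y < x} < card V" if "x \<in> V" for x
    by (rule psubset_card_mono) (use assms that in auto)
  then have sub: "(\<lambda>x. card {y \<in> V. y < x}) ` V \<subseteq> {..n}"
    using assms(2) by (auto simp: less_Suc_eq_le)
  have "(\<lambda>x. card {y \<in> V. y < x}) ` V = {..n}"
    by (rule card_subset_eq[OF _ sub]) (simp_all add: card_image[OF inj] assms(2))
  with inj show ?thesis by (simp add: bij_betw_def)
qed

text \<open>
  Putting \<open>x\<close> in front of an arrangement of \<open>V - {x}\<close> creates as many inversions as \<open>V\<close> has letters
  below \<open>x\<close>, whatever the arrangement, and this rank takes each value below \<open>card V\<close> exactly once.
  The induction ranges over all sets of a given size because the set \<open>V - {x}\<close> varies with \<open>x\<close>.
\<close>

lemma sum_stc_inv: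
  fixes V :: "'a::linorder set"
  assumes "finite V" and "card V = n"
  shows "(\<Sum>w\<in>permutations_of_set V. f (stc_word w) (count_pairs (>) w)) = em_sum n f"
  using assms
proof (induction n arbitrary: V f)
  case 0
  then show ?case by simp
next
  case (Suc n)
  define rank where "rank = (\<lambda>x. card {y \<in> V. y < x})"
  have "V \<noteq> {}" using Suc.prems by auto
  then have split: "permutations_of_set V = (\<Union>x\<in>V. (#) x ` permutations_of_set (V - {x}))"
    by (rule permutations_of_set_nonempty)
  have step: "(\<Sum>w\<in>(#) x ` permutations_of_set (V - {x}). f (stc_word w) (count_pairs (>) w)) =
      em_sum n (\<lambda>r s. f (raise (rank x) r) (s + rank x))" if x: "x \<in> V" for x
  proof -
    have len: "length (filter (\<lambda>y. y < x) w) = rank x" if "w \<in> permutations_of_set (V - {x})" for w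
    proof -
      from that have w: "set w = V - {x}" "distinct w"
        by (auto dest: permutations_of_setD)
      then have "length (filter (\<lambda>y. y < x) w) = card ({y. y < x} \<inter> (V - {x}))"
        by (simp add: distinct_length_filter)
      also have "{y. y < x} \<inter> (V - {x}) = {y \<in> V. y < x}" by auto
      finally show ?thesis by (simp add: rank_def)
    qed
    have "(\<Sum>w\<in>(#) x ` permutations_of_set (V - {x}). f (stc_word w) (count_pairs (>) w)) =
        (\<Sum>w\<in>permutations_of_set (V - {x}). f (raise (rank x) (stc_word w)) (count_pairs (>) w + rank x))"
      by (subst sum.reindex) (auto intro!: sum.cong simp: len add.commute)
    also have "\<dots> = em_sum n (\<lambda>r s. f (raise (rank x) r) (s + rank x))"
      using Suc.prems x by (intro Suc.IH[where f = "\<lambda>r s. f (raise (rank x) r) (s + rank x)"]) auto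
    finally show ?thesis .
  qed
  have "(\<Sum>w\<in>permutations_of_set V. f (stc_word w) (count_pairs (>) w)) =
      (\<Sum>x\<in>V. em_sum n (\<lambda>r s. f (raise (rank x) r) (s + rank x)))"
    unfolding split
    by (subst sum.UNION_disjoint) (use Suc.prems in \<open>auto simp: step\<close>)
  also have "\<dots> = (\<Sum>c\<le>n. em_sum n (\<lambda>r s. f (raise c r) (s + c)))"
    using bij_betw_rank[OF Suc.prems]
    by (intro sum.reindex_bij_betw[where h = rank]) (simp add: rank_def)
  finally show ?case by (simp add: em_sum_sum)
qed

definition insert_at :: "nat \<Rightarrow> 'a \<Rightarrow> 'a list \<Rightarrow> 'a list" where
  "insert_at k m w = take k w @ m # drop k w"

lemma sum_permutations_insert:
  assumes "finite V" and "m \<notin> V"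
  shows "(\<Sum>w\<in>permutations_of_set (insert m V). g w) =
         (\<Sum>w\<in>permutations_of_set V. \<Sum>k\<le>card V. g (insert_at k m w))"
proof -
  have "(\<Sum>w\<in>permutations_of_set V. \<Sum>k\<le>card V. g (insert_at k m w)) =
      (\<Sum>(w, k)\<in>permutations_of_set V \<times> {..card V}. g (insert_at k m w))"
    by (simp add: sum.cartesian_product)
  also have "\<dots> = (\<Sum>w\<in>permutations_of_set (insert m V). g w)"
  proof (rule sum.reindex_bij_witness[where
        j = "\<lambda>(w, k). insert_at k m w" and
        i = "\<lambda>w. (filter (\<lambda>x. x \<noteq> m) w, length (takeWhile (\<lambda>x. x \<noteq> m) w))"], goal_cases)
    case (1 p)
    then obtain w k where p: "p = (w, k)" "set w = V" "k \<le> card V" "distinct w"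
      by (auto dest: permutations_of_setD)
    then have k: "k \<le> length w" by (simp add: distinct_card[symmetric])
    have nm: "\<And>x. x \<in> set (take k w) \<Longrightarrow> x \<noteq> m" "\<And>x. x \<in> set (drop k w) \<Longrightarrow> x \<noteq> m"
      using assms(2) p(2) by (auto dest: in_set_takeD in_set_dropD)
    have "filter (\<lambda>x. x \<noteq> m) (insert_at k m w) = take k w @ drop k w"
      using nm by (simp add: insert_at_def)
    moreover have "takeWhile (\<lambda>x. x \<noteq> m) (insert_at k m w) = take k w"
      using nm by (simp add: insert_at_def takeWhile_append2)
    ultimately show ?case using p k by (simp add: min_absorb2)
  next
    case (2 p)
    then obtain w k where p: "p = (w, k)" "set w = V" "k \<le> card V" "distinct w"
      by (auto dest: permutations_of_setD)
    have "set (insert_at k m w) = insert m V"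
      using p(2) by (metis insert_at_def append_take_drop_id set_append list.set(2) Un_insert_right)
    moreover have "distinct (insert_at k m w)"
      using p assms(2) by (auto simp: insert_at_def set_take_disj_set_drop_if_distinct
          dest: in_set_takeD in_set_dropD)
    ultimately show ?case using p by (simp add: permutations_of_set_def)
  next
    case (3 w)
    then have w: "set w = insert m V" "distinct w" by (auto dest: permutations_of_setD)
    then obtain us vs where u: "w = us @ m # vs" by (metis insertI1 split_list)
    then have nm: "\<And>x. x \<in> set us \<Longrightarrow> x \<noteq> m" "\<And>x. x \<in> set vs \<Longrightarrow> x \<noteq> m" using w by auto
    then have "filter (\<lambda>x. x \<noteq> m) w = us @ vs" by (simp add: u)
    moreover have "takeWhile (\<lambda>x. x \<noteq> m) w = us" using nm by (simp add: u takeWhile_append2)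
    ultimately show ?case by (simp add: insert_at_def u)
  next
    case (4 w)
    then have w: "set w = insert m V" "distinct w" by (auto dest: permutations_of_setD)
    then have f: "set (filter (\<lambda>x. x \<noteq> m) w) = V" "distinct (filter (\<lambda>x. x \<noteq> m) w)"
      using assms(2) by auto
    have "length (takeWhile (\<lambda>x. x \<noteq> m) w) \<le> length (filter (\<lambda>x. x \<noteq> m) w)"
      by (induction w) auto
    also have "\<dots> = card V" using f by (metis distinct_card)
    finally show ?case using f by (simp add: permutations_of_set_def)
  next
    case (5 p)
    then show ?case by auto
  qed
  finally show ?thesis by simp
qed

lemma descents_insert_at:
  assumes "\<forall>x\<in>set w. x < m" and "k < length w"
  shows "descents (insert_at k m w) =
         {d \<in> descents w. d < k} \<union> {Suc k} \<union> Suc ` {d \<in> descents w. k < d}"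
proof -
  have nth: "insert_at k m w ! i = (if i < k then w ! i else if i = k then m else w ! (i - 1))" for i
  proof -
    consider "i < k" | "i = k" | t where "i = Suc (k + t)"
      by (metis less_imp_Suc_add linorder_neqE_nat)
    then show ?thesis
      using assms(2) by cases (auto simp: insert_at_def nth_append Suc_diff_le)
  qed
  have len: "length (insert_at k m w) = Suc (length w)"
    using assms(2) by (simp add: insert_at_def)
  have small: "w ! i < m" if "i < length w" for i using assms(1) that by simp
  have ex: "i \<in> Suc ` A \<longleftrightarrow> 0 < i \<and> i - 1 \<in> A" for i A
    by (cases i) auto
  show ?thesis
  proof (rule set_eqI)
    fix i
    consider "i < k" | "i = k" | "i = Suc k" | "i > Suc k" by linarith
    then show "i \<in> descents (insert_at k m w) \<longleftrightarrow>
        i \<in> {d \<in> descents w. d < k} \<union> {Suc k} \<union> Suc ` {d \<in> descents w. k < d}"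
    proof cases
      case 1
      then show ?thesis using assms(2) by (auto simp: descents_def nth len ex)
    next
      case 2
      have "\<not> m < w ! (k - 1)"
        using small[of "k - 1"] assms(2) by (simp add: less_imp_diff_less not_less less_imp_le)
      with 2 show ?thesis using assms(2) by (auto simp: descents_def nth len ex)
    next
      case 3
      then show ?thesis using assms(2) small[of k] by (auto simp: descents_def nth len ex)
    next
      case 4
      then have "i - 1 - 1 = i - 2" "i - 1 > k" by auto
      with 4 show ?thesis using assms(2) by (auto simp: descents_def nth len ex)
    qed
  qed
qed

lemma descents_append_max:
  assumes "\<forall>x\<in>set w. x < m"
  shows "descents (insert_at (length w) m w) = descents w"
proof -
  have small: "w ! i < m" if "i < length w" for i using assms that by simp
  have "i \<in> descents (w @ [m]) \<longleftrightarrow> i \<in> descents w" for i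
  proof (cases "i = length w")
    case True
    then show ?thesis using small[of "i - 1"] by (cases "i = 0") (auto simp: descents_def nth_append)
  next
    case False
    then show ?thesis by (auto simp: descents_def nth_append)
  qed
  then show ?thesis by (auto simp: insert_at_def)
qed

text \<open>
  The effect on \<open>maj\<close> of inserting a maximum after the first \<open>k\<close> of \<open>n\<close> letters, where \<open>D\<close> is the old
  descent set. At the end nothing changes. Elsewhere \<open>k + 1\<close> becomes a descent, the descents beyond
  \<open>k\<close> move up by one, and \<open>k\<close> is lost if it was a descent: then the first summand is
  \<open>(k + 1) - k\<close> instead of \<open>k + 1\<close>.
\<close>

definition maj_increment :: "nat set \<Rightarrow> nat \<Rightarrow> nat \<Rightarrow> nat" where
  "maj_increment D n k =
     (if k = n then 0 else (if k \<in> D then 1 else Suc k) + card {d \<in> D. k < d})"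

text \<open>
  Let \<open>r = card D\<close>. The increment is \<open>0\<close> at the end, it decreases strictly along the descents with
  values in \<open>{1..r}\<close>, and it increases strictly along the other positions with values in \<open>{r+1..n}\<close>,
  starting from \<open>r + 1\<close> at \<open>k = 0\<close>. So it is injective on \<open>{0..n}\<close>, hence a permutation of it.
\<close>

lemma bij_betw_maj_increment:
  assumes D: "D \<subseteq> {0<..<n}"
  shows "bij_betw (maj_increment D n) {..n} {..n}"
    and "k < n \<Longrightarrow> card D < maj_increment D n k \<longleftrightarrow> k \<notin> D"
proof -
  have fin: "finite D" using D finite_subset by blast
  \<comment> \<open>Moving from \<open>j\<close> to a larger non-descent \<open>k\<close>, \<open>a\<close> drops by the number of descents strictly in
    between, which is less than \<open>k - j\<close>; this is \<open>a_N\<close>.\<close>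
  define a where "a k = card {d \<in> D. k < d}" for k
  have a0: "a 0 = card D"
    unfolding a_def by (rule arg_cong[where f = card]) (use D in auto)
  have a_D: "a k < a j" if "k \<in> D" "j < k" for j k
    unfolding a_def by (rule psubset_card_mono) (use fin that in auto)
  have a_split: "a j = card {d \<in> D. j < d \<and> d \<le> k} + a k" if "j \<le> k" for j k
  proof -
    have "{d \<in> D. j < d} = {d \<in> D. j < d \<and> d \<le> k} \<union> {d \<in> D. k < d}" using that by auto
    moreover have "card ({d \<in> D. j < d \<and> d \<le> k} \<union> {d \<in> D. k < d}) =
        card {d \<in> D. j < d \<and> d \<le> k} + card {d \<in> D. k < d}"
      by (rule card_Un_disjoint) (use fin in auto)
    ultimately show ?thesis by (simp only: a_def)
  qed
  have a_N: "j + a j < k + a k" if "k \<notin> D" "j < k" for j k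
  proof -
    have "card {d \<in> D. j < d \<and> d \<le> k} \<le> card {j<..<k}"
      by (rule card_mono) (use that in \<open>auto simp: less_le\<close>)
    then show ?thesis using a_split[of j k] that by simp
  qed
  have le_D: "1 + a k \<le> card D" if "k \<in> D" for k
    using a_D[of k 0] that D a0 by fastforce
  have ge_N: "card D < Suc k + a k" if "k \<notin> D" for k
    using a_N[of k 0] that a0 by (cases "k = 0") auto
  have le_n: "Suc k + a k \<le> n" if "k < n" for k
  proof -
    have "a k \<le> card {k<..<n}" unfolding a_def by (rule card_mono) (use D in auto)
    then show ?thesis using that by simp
  qed
  have val: "maj_increment D n k = (if k = n then 0 else if k \<in> D then 1 + a k else Suc k + a k)" for k
    by (simp add: maj_increment_def a_def)
  show "card D < maj_increment D n k \<longleftrightarrow> k \<notin> D" if "k < n"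
    using that le_D[of k] ge_N[of k] by (auto simp: val)
  have neq: "maj_increment D n j \<noteq> maj_increment D n k" if "j < k" "k \<le> n" for j k
    using that a_D[of k j] a_N[of k j] le_D[of j] le_D[of k] ge_N[of j] ge_N[of k]
    by (auto simp: val)
  have inj: "inj_on (maj_increment D n) {..n}"
  proof (rule inj_onI)
    fix j k assume "j \<in> {..n}" "k \<in> {..n}" "maj_increment D n j = maj_increment D n k"
    then show "j = k" using neq[of j k] neq[of k j] by (cases j k rule: linorder_cases) auto
  qed
  have sub: "maj_increment D n ` {..n} \<subseteq> {..n}"
  proof (intro image_subsetI)
    fix k assume "k \<in> {..n}"
    then show "maj_increment D n k \<in> {..n}"
      using le_n[of k] by (cases "k = n") (auto simp: val)
  qed
  have "maj_increment D n ` {..n} = {..n}"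
    by (rule card_subset_eq[OF _ sub]) (simp_all add: card_image[OF inj])
  with inj show "bij_betw (maj_increment D n) {..n} {..n}" by (simp add: bij_betw_def)
qed

lemma insert_at_des_maj:
  assumes "\<forall>x\<in>set w. x < m" and "k \<le> length w"
  defines "c \<equiv> maj_increment (descents w) (length w) k"
  shows "card (descents (insert_at k m w)) = raise c (card (descents w))"
    and "\<Sum>(descents (insert_at k m w)) = \<Sum>(descents w) + c"
proof -
  define D where "D = descents w"
  have fin: "finite D" by (simp add: D_def)
  have "card (descents (insert_at k m w)) = raise c (card D) \<and>
      \<Sum>(descents (insert_at k m w)) = \<Sum>D + c"
  proof (cases "k = length w")
    case True
    then show ?thesis
      using descents_append_max[OF assms(1)] by (simp add: c_def maj_increment_def D_def raise_def)
  next
    case False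
    then have k: "k < length w" using assms(2) by simp
    define A where "A = {d \<in> D. d < k}"
    define B where "B = {d \<in> D. k < d}"
    have finAB: "finite A" "finite B" using fin by (auto simp: A_def B_def)
    have new: "descents (insert_at k m w) = insert (Suc k) (A \<union> Suc ` B)"
      using descents_insert_at[OF assms(1) k] by (auto simp: D_def A_def B_def)
    have disj: "Suc k \<notin> A \<union> Suc ` B" "A \<inter> Suc ` B = {}" "A \<inter> B = {}" "k \<notin> A \<union> B"
      by (auto simp: A_def B_def)
    have cardB: "card (Suc ` B) = card B" by (simp add: card_image)
    have sumB: "\<Sum>(Suc ` B) = \<Sum>B + card B"
      using sum_Suc[of "\<lambda>d. d" B] by (simp add: sum.reindex)
    have card_new: "card (descents (insert_at k m w)) = Suc (card A + card B)"
      using finAB disj by (simp add: new card_Un_disjoint cardB)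
    have sum_new: "\<Sum>(descents (insert_at k m w)) = Suc k + \<Sum>A + \<Sum>B + card B"
      using finAB disj by (simp add: new sum.union_disjoint sumB)
    have gt: "card D < c \<longleftrightarrow> k \<notin> D"
      unfolding c_def D_def
      by (rule bij_betw_maj_increment(2)[OF _ k]) (auto simp: descents_def)
    have c: "c = (if k \<in> D then 1 else Suc k) + card B"
      using k by (simp add: c_def maj_increment_def B_def D_def)
    show ?thesis
    proof (cases "k \<in> D")
      case True
      then have "D = insert k (A \<union> B)" by (auto simp: A_def B_def)
      then have "card D = Suc (card A + card B)" "\<Sum>D = k + \<Sum>A + \<Sum>B"
        using finAB disj by (simp_all add: card_Un_disjoint sum.union_disjoint)
      then show ?thesis using True gt c card_new sum_new by (simp add: raise_def)
    next
      case False
      then have "D = A \<union> B" by (auto simp: A_def B_def not_less_iff_gr_or_eq)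
      then have "card D = card A + card B" "\<Sum>D = \<Sum>A + \<Sum>B"
        using finAB disj by (simp_all add: card_Un_disjoint sum.union_disjoint)
      then show ?thesis using False gt c card_new sum_new by (simp add: raise_def)
    qed
  qed
  then show "card (descents (insert_at k m w)) = raise c (card (descents w))"
    and "\<Sum>(descents (insert_at k m w)) = \<Sum>(descents w) + c"
    by (simp_all add: D_def)
qed

text \<open>
  Induction by adding a new maximum; for each old arrangement, the insertion positions are
  reindexed by the increment of \<open>maj\<close>.
\<close>

lemma sum_des_maj:
  fixes V :: "'a::linorder set"
  assumes "finite V"
  shows "(\<Sum>w\<in>permutations_of_set V. f (card (descents w)) (\<Sum>(descents w))) = em_sum (card V) f"
  using assms
proof (induction V arbitrary: f rule: finite_linorder_max_induct)
  case empty
  then show ?case by (simp add: descents_def)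
next
  case (insert m V)
  define n where "n = card V"
  have m: "m \<notin> V" using insert.hyps by auto
  have step: "(\<Sum>k\<le>n. f (card (descents (insert_at k m w))) (\<Sum>(descents (insert_at k m w)))) =
      (\<Sum>c\<le>n. f (raise c (card (descents w))) (\<Sum>(descents w) + c))"
    if "w \<in> permutations_of_set V" for w
  proof -
    from that have w: "set w = V" "distinct w" by (auto dest: permutations_of_setD)
    then have len: "length w = n" by (simp add: n_def distinct_card[symmetric])
    have "bij_betw (maj_increment (descents w) n) {..n} {..n}"
      by (rule bij_betw_maj_increment) (auto simp: descents_def len)
    note reindex = sum.reindex_bij_betw[OF this,
        of "\<lambda>c. f (raise c (card (descents w))) (\<Sum>(descents w) + c)"]
    show ?thesis
      unfolding reindex[symmetric]
      using insert_at_des_maj[of w m] insert.hyps(2) w(1) len by (intro sum.cong) auto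
  qed
  have "(\<Sum>w\<in>permutations_of_set (insert m V). f (card (descents w)) (\<Sum>(descents w))) =
      (\<Sum>w\<in>permutations_of_set V. \<Sum>c\<le>n. f (raise c (card (descents w))) (\<Sum>(descents w) + c))"
    using insert.hyps(1) m by (subst sum_permutations_insert) (simp_all add: step n_def[symmetric])
  also have "\<dots> = em_sum n (\<lambda>r s. \<Sum>c\<le>n. f (raise c r) (s + c))"
    unfolding n_def by (rule insert.IH)
  finally show ?case using insert.hyps(1) m by (simp add: n_def)
qed

theorem stc_inv_equidistributed_des_maj:
  fixes V :: "'a::linorder set"
  assumes "finite V"
  shows "(\<Sum>w\<in>permutations_of_set V. f (stc_word w) (count_pairs (>) w)) =
         (\<Sum>w\<in>permutations_of_set V. f (card (descents w)) (\<Sum>(descents w)))"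
  using assms by (simp add: sum_stc_inv sum_des_maj)

section \<open>Signed permutations as words\<close>

text \<open>
  The entries at the positions \<open>1, \<dots>, n\<close> fix those at \<open>-1, \<dots>, -n\<close> by oddness, and everything else is
  fixed pointwise. Conversely this extension of a word is a bijection as soon as the absolute
  values of the letters are \<open>1, \<dots>, n\<close>, each occurring once.
\<close>

lemma word_bij:
  "bij_betw (word n) (hyperoctahedral n) {w. distinct w \<and> bij_betw abs (set w) {1..int n}}"
    (is "bij_betw _ _ ?W")
proof (rule bij_betw_imageI)
  let ?S = "{- int n..int n} - {0}"
  show "inj_on (word n) (hyperoctahedral n)"
  proof (rule inj_onI, rule ext)
    fix \<sigma> \<tau> i assume s: "\<sigma> \<in> hyperoctahedral n" "\<tau> \<in> hyperoctahedral n" "word n \<sigma> = word n \<tau>"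
    have pos: "\<sigma> j = \<tau> j" if "j \<in> {1..int n}" for j
      using that s(3) nth_word[of "nat j - 1" n \<sigma>] nth_word[of "nat j - 1" n \<tau>] by (auto simp: of_nat_diff)
    have odd: "\<sigma> (- j) = - \<sigma> j" "\<tau> (- j) = - \<tau> j" for j
      using s by (auto simp: hyperoctahedral_def)
    have "i \<in> {1..int n} \<or> - i \<in> {1..int n} \<or> i \<notin> ?S"
      by (cases "i > 0"; cases "i < 0") auto
    then consider "i \<in> {1..int n}" | "- i \<in> {1..int n}" | "i \<notin> ?S" by blast
    then show "\<sigma> i = \<tau> i"
    proof cases
      case 2
      then show ?thesis using pos[of "- i"] odd[of "- i"] by simp
    next
      case 3
      then have "\<sigma> i = i" "\<tau> i = i"
        using s by (auto simp: hyperoctahedral_def permutes_not_in)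
      then show ?thesis by simp
    qed (rule pos)
  qed
  show "word n ` hyperoctahedral n = ?W"
  proof (intro equalityI subsetI)
    fix w assume "w \<in> word n ` hyperoctahedral n"
    then obtain \<sigma> where w: "w = word n \<sigma>" and perm: "\<sigma> permutes ?S"
      and odd: "\<And>i. \<sigma> (- i) = - \<sigma> i" by (auto simp: hyperoctahedral_def)
    have inj: "\<sigma> i = \<sigma> j \<longleftrightarrow> i = j" for i j
      using permutes_inj[OF perm] by (auto dest: injD)
    have set: "set w = \<sigma> ` {1..int n}"
    proof -
      have "set w = \<sigma> ` (int ` {1..n})" unfolding w word_def by (simp add: image_image atLeastLessThanSuc_atLeastAtMost del: upt_Suc)
      then show ?thesis by (simp add: image_int_atLeastAtMost)
    qed
    have "distinct w"
      by (auto simp: w distinct_conv_nth nth_word inj)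
    moreover have "inj_on abs (set w)"
    proof (rule inj_onI)
      fix u v assume "u \<in> set w" "v \<in> set w" and abs: "\<bar>u\<bar> = \<bar>v\<bar>"
      then obtain i j where ij: "u = \<sigma> i" "v = \<sigma> j" "i \<ge> 1" "j \<ge> 1" by (auto simp: set)
      with abs have "\<sigma> i = \<sigma> j \<or> \<sigma> i = \<sigma> (- j)" by (auto simp: odd abs_eq_iff)
      then show "u = v" using ij by (auto simp: inj)
    qed
    moreover have "abs ` set w = {1..int n}"
    proof (intro equalityI subsetI)
      fix v assume "v \<in> abs ` set w"
      then obtain i where i: "v = \<bar>\<sigma> i\<bar>" "i \<in> ?S" by (force simp: set)
      then show "v \<in> {1..int n}" using permutes_in_image[OF perm, of i] by auto
    next
      fix v assume v: "v \<in> {1..int n}"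
      then have "v \<in> \<sigma> ` ?S" using permutes_image[OF perm] by auto
      then obtain i where i: "i \<in> ?S" "v = \<sigma> i" by blast
      show "v \<in> abs ` set w"
      proof (cases "i > 0")
        case True
        then have "v \<in> set w" using i by (auto simp: set)
        then show ?thesis using v by (intro image_eqI[of _ _ v]) auto
      next
        case False
        then have "- v \<in> set w" using i odd[of i] by (auto simp: set intro!: image_eqI[of _ _ "- i"])
        then show ?thesis using v by (intro image_eqI[of _ _ "- v"]) auto
      qed
    qed
    ultimately show "w \<in> ?W" by (simp add: bij_betw_def)
  next
    fix w assume "w \<in> ?W"
    then have w: "distinct w" "inj_on abs (set w)" "abs ` set w = {1..int n}"
      by (auto simp: bij_betw_def)
    have len: "length w = n"
      using w by (metis card_image distinct_card card_atLeastAtMost_int diff_add_cancel nat_int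
          add_diff_cancel_right')
    define p where "p = (\<lambda>i. w ! (nat i - 1))"
    define \<sigma> where "\<sigma> = (\<lambda>i. if i \<in> {1..int n} then p i else if - i \<in> {1..int n} then - p (- i) else i)"
    have p_mem: "p i \<in> set w" if "i \<in> {1..int n}" for i
      using that len by (auto simp: p_def)
    have p_abs: "\<bar>p i\<bar> \<in> {1..int n}" if "i \<in> {1..int n}" for i
      using p_mem[OF that] w(3) by blast
    have p_inj: "i = j" if "i \<in> {1..int n}" "j \<in> {1..int n}" "\<bar>p i\<bar> = \<bar>p j\<bar>" for i j
    proof -
      have "p i = p j" using that p_mem w(2) by (meson inj_onD)
      then have "nat i - 1 = nat j - 1"
        using that w(1) len by (auto simp: p_def nth_eq_iff_index_eq)
      then show ?thesis using that by auto
    qed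
    have odd: "\<sigma> (- i) = - \<sigma> i" for i
      by (auto simp: \<sigma>_def)
    have abs_\<sigma>: "\<bar>\<sigma> i\<bar> = \<bar>p \<bar>i\<bar>\<bar>" "\<bar>i\<bar> \<in> {1..int n}" if "i \<in> ?S" for i
      using that by (auto simp: \<sigma>_def)
    have "inj_on \<sigma> ?S"
    proof (rule inj_onI)
      fix i j assume ij: "i \<in> ?S" "j \<in> ?S" "\<sigma> i = \<sigma> j"
      then have "\<bar>p \<bar>i\<bar>\<bar> = \<bar>p \<bar>j\<bar>\<bar>"
        by (metis abs_\<sigma>(1))
      then have "\<bar>i\<bar> = \<bar>j\<bar>"
        by (rule p_inj[OF abs_\<sigma>(2)[OF ij(1)] abs_\<sigma>(2)[OF ij(2)]])
      then consider "i = j" | "i = - j" by linarith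
      then show "i = j"
      proof cases
        case 2
        then have "\<sigma> j = 0" using ij(3) odd[of j] by simp
        then show ?thesis using abs_\<sigma>[OF ij(2)] p_abs[of "\<bar>j\<bar>"] by auto
      qed
    qed
    moreover have "\<sigma> ` ?S \<subseteq> ?S"
    proof
      fix v assume "v \<in> \<sigma> ` ?S"
      then obtain i where "i \<in> ?S" "v = \<sigma> i" by blast
      then have "\<bar>v\<bar> \<in> {1..int n}" using abs_\<sigma>[of i] p_abs[of "\<bar>i\<bar>"] by simp
      then show "v \<in> ?S" by auto
    qed
    ultimately have "bij_betw \<sigma> ?S ?S"
      by (simp add: bij_betw_def endo_inj_surj)
    then have "\<sigma> permutes ?S"
      by (rule bij_imp_permutes) (auto simp: \<sigma>_def)
    then have "\<sigma> \<in> hyperoctahedral n" using odd by (simp add: hyperoctahedral_def)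
    moreover have "word n \<sigma> = w"
      by (rule nth_equalityI) (auto simp: len nth_word \<sigma>_def p_def nat_add_distrib)
    ultimately show "w \<in> word n ` hyperoctahedral n" by blast
  qed
qed

lemma sum_word_positions:
  assumes "distinct (word n \<sigma>)"
  shows "(\<Sum>i | i \<in> {1..n} \<and> P (\<sigma> (int i)). g (\<sigma> (int i))) =
         (\<Sum>v | v \<in> set (word n \<sigma>) \<and> P v. g v)"
proof -
  have inj: "inj_on (\<lambda>i. \<sigma> (int i)) {1..n}"
    using assms by (simp add: word_def distinct_map atLeastLessThanSuc_atLeastAtMost del: upt_Suc)
  have "{v \<in> set (word n \<sigma>). P v} = (\<lambda>i. \<sigma> (int i)) ` {i \<in> {1..n}. P (\<sigma> (int i))}"
    by (auto simp: word_def atLeastLessThanSuc_atLeastAtMost simp del: upt_Suc)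
  moreover have "inj_on (\<lambda>i. \<sigma> (int i)) {i \<in> {1..n}. P (\<sigma> (int i))}"
    by (rule inj_on_subset[OF inj]) auto
  ultimately show ?thesis by (simp add: sum.reindex)
qed

text \<open>
  Among two letters of different absolute value, the larger absolute value decides the sign of the
  sum. Each pair with negative sum is counted at its dominating letter, so the count does not
  depend on the order of the letters. In the induction step, \<open>A\<close> collects the letters dominated by a
  negative new letter \<open>x\<close>, and \<open>B\<close> the negative letters that dominate \<open>x\<close>.
\<close>

lemma count_negative_pairs:
  assumes "distinct w" and "inj_on abs (set w)"
  shows "count_pairs (\<lambda>x y. x + y < (0::int)) w =
         (\<Sum>v | v \<in> set w \<and> v < 0. card {u \<in> set w. \<bar>u\<bar> < \<bar>v\<bar>})"
  using assms
proof (induction w)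
  case (Cons x w)
  define A where "A = {y \<in> set w. x < 0 \<and> \<bar>y\<bar> < \<bar>x\<bar>}"
  define B where "B = {y \<in> set w. y < 0 \<and> \<bar>x\<bar> < \<bar>y\<bar>}"
  have neq: "\<bar>y\<bar> \<noteq> \<bar>x\<bar>" if "y \<in> set w" for y
    using Cons.prems that by (auto simp: inj_on_def)
  have x: "x \<notin> set w" using Cons.prems by simp
  have "length (filter (\<lambda>y. x + y < 0) w) = card ({y. x + y < 0} \<inter> set w)"
    using Cons.prems by (simp add: distinct_length_filter)
  also have "{y. x + y < 0} \<inter> set w = A \<union> B"
    using neq by (fastforce simp: A_def B_def)
  also have "card (A \<union> B) = card A + card B"
    by (rule card_Un_disjoint) (auto simp: A_def B_def)
  finally have first: "length (filter (\<lambda>y. x + y < 0) w) = card A + card B" .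
  have new: "card {u \<in> set (x # w). \<bar>u\<bar> < \<bar>v\<bar>} =
      card {u \<in> set w. \<bar>u\<bar> < \<bar>v\<bar>} + (if \<bar>x\<bar> < \<bar>v\<bar> then 1 else 0)" for v
  proof -
    have "{u \<in> set (x # w). \<bar>u\<bar> < \<bar>v\<bar>} =
        (if \<bar>x\<bar> < \<bar>v\<bar> then insert x {u \<in> set w. \<bar>u\<bar> < \<bar>v\<bar>} else {u \<in> set w. \<bar>u\<bar> < \<bar>v\<bar>})"
      by auto
    then show ?thesis using x by simp
  qed
  have old: "(\<Sum>v | v \<in> set w \<and> v < 0. card {u \<in> set (x # w). \<bar>u\<bar> < \<bar>v\<bar>}) =
      (\<Sum>v | v \<in> set w \<and> v < 0. card {u \<in> set w. \<bar>u\<bar> < \<bar>v\<bar>}) + card B"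
  proof -
    have "(\<Sum>v | v \<in> set w \<and> v < 0. if \<bar>x\<bar> < \<bar>v\<bar> then 1 else 0) = card B"
      by (simp add: sum.If_cases B_def) (rule arg_cong[where f = card], auto)
    then show ?thesis by (simp only: new sum.distrib)
  qed
  have "(\<Sum>v | v \<in> set (x # w) \<and> v < 0. card {u \<in> set (x # w). \<bar>u\<bar> < \<bar>v\<bar>}) =
      card A + (\<Sum>v | v \<in> set w \<and> v < 0. card {u \<in> set (x # w). \<bar>u\<bar> < \<bar>v\<bar>})"
  proof (cases "x < 0")
    case True
    have neg: "{v \<in> set (x # w). v < 0} = insert x {v \<in> set w. v < 0}" using True by auto
    have smaller: "{u \<in> set (x # w). \<bar>u\<bar> < \<bar>x\<bar>} = A" using True by (auto simp: A_def)
    show ?thesis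
      unfolding neg
      by (subst sum.insert) (use x in \<open>simp_all only: smaller\<close>, auto)
  next
    case False
    then have "{v \<in> set (x # w). v < 0} = {v \<in> set w. v < 0}" "A = {}" by (auto simp: A_def)
    then show ?thesis by (simp only: card.empty add_0)
  qed
  then show ?case
    using Cons first old by simp
qed simp

text \<open>
  This is \<open>nsp\<close> of every signed permutation with letter set \<open>V\<close>, and at the same time the part of
  \<open>dmaj\<close> that is due to the signs.
\<close>

definition sign_weight :: "int set \<Rightarrow> nat" where
  "sign_weight V = (\<Sum>v | v \<in> V \<and> v < 0. nat (\<bar>v\<bar> - 1))"

lemma card_smaller_abs:
  assumes "bij_betw abs V {1..int n}" and "v \<in> V"
  shows "card {u \<in> V. \<bar>u\<bar> < \<bar>v\<bar>} = nat (\<bar>v\<bar> - 1)"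
proof -
  have inj: "inj_on abs V" and img: "abs ` V = {1..int n}"
    using assms(1) by (auto simp: bij_betw_def)
  have "\<bar>v\<bar> \<in> {1..int n}" using assms(2) img by blast
  then have "{1..<\<bar>v\<bar>} \<subseteq> abs ` V" unfolding img by auto
  then have "{1..<\<bar>v\<bar>} \<subseteq> abs ` {u \<in> V. \<bar>u\<bar> < \<bar>v\<bar>}" by force
  moreover have "abs ` {u \<in> V. \<bar>u\<bar> < \<bar>v\<bar>} \<subseteq> {1..<\<bar>v\<bar>}" using img by force
  ultimately have "abs ` {u \<in> V. \<bar>u\<bar> < \<bar>v\<bar>} = {1..<\<bar>v\<bar>}" by (rule subset_antisym[rotated])
  moreover have "card (abs ` {u \<in> V. \<bar>u\<bar> < \<bar>v\<bar>}) = card {u \<in> V. \<bar>u\<bar> < \<bar>v\<bar>}"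
    by (intro card_image inj_on_subset[OF inj]) auto
  ultimately show ?thesis by simp
qed

text \<open>
  Each statistic is one of the arrangement \<open>w\<close> plus a constant of the letter set \<open>V\<close>. The letter
  \<open>-1\<close>, which \<open>dmaj\<close> leaves out, would contribute \<open>\<bar>-1\<bar> - 1 = 0\<close> to the weight.
\<close>

lemma signed_statistics:
  assumes "\<sigma> \<in> hyperoctahedral n"
  defines "w \<equiv> word n \<sigma>"
  defines "V \<equiv> set w"
  shows "neg n \<sigma> = card {v \<in> V. v < 0}"
    and "dstc n \<sigma> = stc_word w + card {v \<in> V. v < - 1}"
    and "length_D n \<sigma> = count_pairs (>) w + sign_weight V"
    and "ddes n \<sigma> = card (descents w) + card {v \<in> V. v < - 1}"
    and "dmaj n \<sigma> = \<Sum>(descents w) + sign_weight V"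
proof -
  have "w \<in> word n ` hyperoctahedral n" using assms by auto
  then have w: "distinct w" "bij_betw abs V {1..int n}"
    using word_bij[of n] by (auto simp: bij_betw_def V_def)
  note positions = sum_word_positions[OF w(1)[unfolded w_def], folded w_def, folded V_def]
  show "neg n \<sigma> = card {v \<in> V. v < 0}"
    using positions[where P = "\<lambda>v. v < 0" and g = "\<lambda>_. 1::nat"] by (simp add: neg_def Neg_def)
  have DNeg: "card (DNeg n \<sigma>) = card {v \<in> V. v < - 1}"
    using positions[where P = "\<lambda>v. v < - 1" and g = "\<lambda>_. 1::nat"] by (simp add: DNeg_def)
  show "dstc n \<sigma> = stc_word w + card {v \<in> V. v < - 1}"
    by (simp add: dstc_def stc_eq_stc_word DNeg w_def)
  show "ddes n \<sigma> = card (descents w) + card {v \<in> V. v < - 1}"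
    by (simp add: ddes_def des_def Des_eq_descents DNeg w_def)
  have "nsp n \<sigma> = count_pairs (\<lambda>x y. x + y < 0) w"
    unfolding nsp_def w_def by (rule card_pairs_eq_count_pairs)
  also have "\<dots> = (\<Sum>v | v \<in> V \<and> v < 0. card {u \<in> V. \<bar>u\<bar> < \<bar>v\<bar>})"
    using w unfolding V_def by (intro count_negative_pairs) (auto simp: bij_betw_def)
  also have "\<dots> = sign_weight V"
    unfolding sign_weight_def by (intro sum.cong refl card_smaller_abs[OF w(2)]) auto
  finally show "length_D n \<sigma> = count_pairs (>) w + sign_weight V"
    unfolding length_D_def inversions_def w_def
    using card_pairs_eq_count_pairs[of n "(>)" \<sigma>] by simp
  have "(\<Sum>i\<in>DNeg n \<sigma>. nat (\<bar>\<sigma> (int i)\<bar> - 1)) = (\<Sum>v | v \<in> V \<and> v < - 1. nat (\<bar>v\<bar> - 1))"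
    unfolding DNeg_def by (rule positions)
  also have "\<dots> = sign_weight V"
    unfolding sign_weight_def by (rule sum.mono_neutral_left) (auto simp: V_def)
  finally show "dmaj n \<sigma> = \<Sum>(descents w) + sign_weight V"
    by (simp add: dmaj_def maj_def Des_eq_descents w_def)
qed

text \<open>
  The fibres of the letter-set map are all the arrangements of a set \<open>V\<close>: membership in \<open>D\<^sub>n\<close> asks
  only that \<open>V\<close> have one letter of each absolute value and an even number of negative ones.
\<close>

lemma sum_even_hyperoctahedral:
  assumes "\<And>\<sigma>. \<sigma> \<in> hyperoctahedral n \<Longrightarrow> g \<sigma> = h (word n \<sigma>)"
  shows "(\<Sum>\<sigma>\<in>even_hyperoctahedral n. g \<sigma>) =
         (\<Sum>V | bij_betw abs V {1..int n} \<and> even (card {v \<in> V. v < 0}).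
            \<Sum>w\<in>permutations_of_set V. h w)"
proof -
  define \<V> where "\<V> = {V. bij_betw abs V {1..int n} \<and> even (card {v \<in> V. v < 0})}"
  define W where "W = {w. distinct w \<and> set w \<in> \<V>}"
  have bij: "bij_betw (word n) (even_hyperoctahedral n) W"
  proof -
    have words: "word n ` hyperoctahedral n = {w. distinct w \<and> bij_betw abs (set w) {1..int n}}"
      using word_bij by (rule bij_betw_imp_surj_on)
    have even: "even (neg n \<sigma>) \<longleftrightarrow> even (card {v \<in> set (word n \<sigma>). v < 0})"
      if "\<sigma> \<in> hyperoctahedral n" for \<sigma>
      using signed_statistics(1)[OF that] by simp
    have "W = word n ` even_hyperoctahedral n"
    proof (intro equalityI subsetI)
      fix w assume "w \<in> W"
      then have "w \<in> word n ` hyperoctahedral n" "even (card {v \<in> set w. v < 0})"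
        unfolding words by (auto simp: W_def \<V>_def)
      then show "w \<in> word n ` even_hyperoctahedral n"
        using even by (auto simp: even_hyperoctahedral_def)
    next
      fix w assume "w \<in> word n ` even_hyperoctahedral n"
      then obtain \<sigma> where \<sigma>: "\<sigma> \<in> hyperoctahedral n" "even (neg n \<sigma>)" "w = word n \<sigma>"
        by (auto simp: even_hyperoctahedral_def)
      then have "w \<in> word n ` hyperoctahedral n" by blast
      then show "w \<in> W" using \<sigma> even[OF \<sigma>(1)] unfolding words by (simp add: W_def \<V>_def)
    qed
    moreover have "inj_on (word n) (even_hyperoctahedral n)"
      using bij_betw_imp_inj_on[OF word_bij[of n]]
      by (rule inj_on_subset) (auto simp: even_hyperoctahedral_def)
    ultimately show ?thesis by (simp add: bij_betw_def)
  qed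
  have "finite W" using bij finite_even_hyperoctahedral by (metis bij_betw_finite)
  have sub: "V \<subseteq> {- int n..int n}" if "V \<in> \<V>" for V
  proof
    fix v assume "v \<in> V"
    then have "\<bar>v\<bar> \<in> {1..int n}" using that by (auto simp: \<V>_def bij_betw_def)
    then show "v \<in> {- int n..int n}" by auto
  qed
  then have fin: "finite \<V>" by (intro finite_subset[of \<V> "Pow {- int n..int n}"]) auto
  have "(\<Sum>\<sigma>\<in>even_hyperoctahedral n. g \<sigma>) = (\<Sum>\<sigma>\<in>even_hyperoctahedral n. h (word n \<sigma>))"
    using assms by (intro sum.cong) (auto simp: even_hyperoctahedral_def)
  also have "\<dots> = (\<Sum>w\<in>W. h w)"
    by (rule sum.reindex_bij_betw[OF bij])
  also have "\<dots> = (\<Sum>V\<in>\<V>. \<Sum>w\<in>{w \<in> W. set w = V}. h w)"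
    by (rule sum.group[symmetric]) (use \<open>finite W\<close> fin in \<open>auto simp: W_def\<close>)
  also have "\<dots> = (\<Sum>V\<in>\<V>. \<Sum>w\<in>permutations_of_set V. h w)"
    by (intro sum.cong) (auto simp: W_def permutations_of_set_def)
  finally show ?thesis by (simp add: \<V>_def)
qed

theorem theorem3p7:
  fixes n :: nat and x q :: "'a :: comm_semiring_1"
  shows "(\<Sum>\<sigma>\<in>even_hyperoctahedral n. x ^ dstc n \<sigma> * q ^ length_D n \<sigma>) =
         (\<Sum>\<sigma>\<in>even_hyperoctahedral n. x ^ ddes n \<sigma> * q ^ dmaj n \<sigma>)"
proof -
  define a where "a V = card {v \<in> V. v < (- 1 :: int)}" for V
  have fibre: "(\<Sum>w\<in>permutations_of_set V.
          x ^ (stc_word w + a (set w)) * q ^ (count_pairs (>) w + sign_weight (set w))) =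
        (\<Sum>w\<in>permutations_of_set V.
          x ^ (card (descents w) + a (set w)) * q ^ (\<Sum>(descents w) + sign_weight (set w)))"
    if "bij_betw abs V {1..int n}" for V
  proof -
    have "finite V" using bij_betw_finite[OF that] by simp
    from stc_inv_equidistributed_des_maj[OF this,
        where f = "\<lambda>r s. x ^ (r + a V) * q ^ (s + sign_weight V)"]
    show ?thesis by (simp add: permutations_of_set_def)
  qed
  have stc: "(\<Sum>\<sigma>\<in>even_hyperoctahedral n. x ^ dstc n \<sigma> * q ^ length_D n \<sigma>) =
      (\<Sum>V | bij_betw abs V {1..int n} \<and> even (card {v \<in> V. v < 0}).
         \<Sum>w\<in>permutations_of_set V.
           x ^ (stc_word w + a (set w)) * q ^ (count_pairs (>) w + sign_weight (set w)))"
    by (rule sum_even_hyperoctahedral) (simp add: signed_statistics a_def)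
  have des: "(\<Sum>\<sigma>\<in>even_hyperoctahedral n. x ^ ddes n \<sigma> * q ^ dmaj n \<sigma>) =
      (\<Sum>V | bij_betw abs V {1..int n} \<and> even (card {v \<in> V. v < 0}).
         \<Sum>w\<in>permutations_of_set V.
           x ^ (card (descents w) + a (set w)) * q ^ (\<Sum>(descents w) + sign_weight (set w)))"
    by (rule sum_even_hyperoctahedral) (simp add: signed_statistics a_def)
  show ?thesis
    unfolding stc des by (intro sum.cong refl fibre) simp
qed

end
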